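(* Let $G$ be a compact Lie group and let $K_1,K_2$ be completely normal $G$-spaces. If $p_i\colon E_i\to B_i$ and $f_i\colon K_i\to B_i$ are $G$-maps for $i=1,2$, then $f_1\times f_2\colon K_1\times K_2\to B_1\times B_2$ and $p_1\times p_2\colon E_1\times E_2\to B_1\times B_2$ can be regarded as $G$-maps (with respect to the diagonal actions), and $$\mathrm{secat}_{G,f_1\times f_2}(p_1\times p_2)\le \mathrm{secat}_{G,f_1}(p_1)+\mathrm{secat}_{G,f_2}(p_2).$$
   Context: A $G$-space is a Hausdorff space with a continuous left $G$-action; a $G$-map is a continuous $G$-equivariant map. Two $G$-maps $u,v\colon X\to Y$ are $G$-homotopic, written $u\simeq_G v$, if there is a $G$-map $X\times I\to Y$ (with $I=[0,1]$ carrying the trivial action) restricting to $u$ and $v$ at the ends. The diagonal action on a product is $g(x,y)=(gx,gy)$. For $G$-maps $p\colon E\to B$ and $f\colon K\to B$, the equivariant relative sectional category $\mathrm{secat}_{G,f}(p)$ is the smallest non-negative integer $n$ such that there is a $G$-invariant open cover $\{U_0,\dots,U_n\}$ of $K$ with $G$-maps $s_i\colon U_i\to E$ satisfying $p\circ s_i\simeq_G f|_{U_i}$ for each $i$ ($\infty$ if there is no such $n$). *)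

theory Defs
  imports "HOL-Analysis.Analysis" "HOL-Algebra.Group" "HOL-Library.Extended_Nat"
begin

section \<open>Smooth maps between open subsets of Euclidean spaces\<close>

text \<open>Euclidean n-space is the library's \<^const>\<open>Euclidean_space\<close>, whose points are the functions
  \<^typ>\<open>nat \<Rightarrow> real\<close> that vanish from index \<open>n\<close> on; this includes dimension 0, which is needed for finite
  groups. For \<open>S\<close> open in it, \<open>Ck_on n k S f\<close> says that all partial derivatives of
  \<open>f\<close> of order at most \<open>k\<close> exist and are continuous on \<open>S\<close>. The line through \<open>x\<close> in the \<open>i\<close>-th coordinate
  direction is \<open>t \<mapsto> x(i := t)\<close>, reaching \<open>x\<close> at \<open>t = x i\<close>.\<close>

primrec Ck_on :: "nat \<Rightarrow> nat \<Rightarrow> (nat \<Rightarrow> real) set \<Rightarrow> ((nat \<Rightarrow> real) \<Rightarrow> real) \<Rightarrow> bool" where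
  "Ck_on n 0 S f \<longleftrightarrow> continuous_map (subtopology (Euclidean_space n) S) euclideanreal f"
| "Ck_on n (Suc k) S f \<longleftrightarrow>
     continuous_map (subtopology (Euclidean_space n) S) euclideanreal f \<and>
     (\<forall>i<n. (\<forall>x\<in>S. (\<lambda>t. f (x(i := t))) field_differentiable (at (x i))) \<and>
            Ck_on n k S (\<lambda>x. deriv (\<lambda>t. f (x(i := t))) (x i)))"

definition smooth_on ::
  "nat \<Rightarrow> nat \<Rightarrow> (nat \<Rightarrow> real) set \<Rightarrow> ((nat \<Rightarrow> real) \<Rightarrow> nat \<Rightarrow> real) \<Rightarrow> bool" where
  "smooth_on n m S f \<longleftrightarrow>
     f ` S \<subseteq> topspace (Euclidean_space m) \<and> (\<forall>j<m. \<forall>k. Ck_on n k S (\<lambda>x. f x j))"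

section \<open>Smooth manifolds and Lie groups\<close>

text \<open>A chart is a pair of an open set and a homeomorphism from it onto an open subset of
  Euclidean space; outside its domain the function is irrelevant.\<close>

type_synonym 'a chart = "'a set \<times> ('a \<Rightarrow> nat \<Rightarrow> real)"

definition is_chart :: "'a topology \<Rightarrow> nat \<Rightarrow> 'a chart \<Rightarrow> bool" where
  "is_chart T n = (\<lambda>(U, \<phi>). openin T U \<and> openin (Euclidean_space n) (\<phi> ` U) \<and>
     homeomorphic_map (subtopology T U) (subtopology (Euclidean_space n) (\<phi> ` U)) \<phi>)"

definition smooth_manifold :: "'a topology \<Rightarrow> nat \<Rightarrow> 'a chart set \<Rightarrow> bool" where
  "smooth_manifold T n A \<longleftrightarrow>
     Hausdorff_space T \<and> second_countable T \<and>
     (\<forall>c\<in>A. is_chart T n c) \<and> (\<Union>c\<in>A. fst c) = topspace T \<and>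
     (\<forall>(U, \<phi>)\<in>A. \<forall>(V, \<psi>)\<in>A. smooth_on n n (\<phi> ` (U \<inter> V)) (\<lambda>z. \<psi> (inv_into U \<phi> z)))"

definition smooth_map ::
  "'a topology \<Rightarrow> nat \<Rightarrow> 'a chart set \<Rightarrow> 'b topology \<Rightarrow> nat \<Rightarrow> 'b chart set \<Rightarrow> ('a \<Rightarrow> 'b) \<Rightarrow> bool" where
  "smooth_map T n A T' m A' f \<longleftrightarrow>
     continuous_map T T' f \<and>
     (\<forall>(U, \<phi>)\<in>A. \<forall>(V, \<psi>)\<in>A'.
        smooth_on n m (\<phi> ` {x \<in> U. f x \<in> V}) (\<lambda>z. \<psi> (f (inv_into U \<phi> z))))"

text \<open>The product atlas, using that Euclidean \<open>n\<close>-space times Euclidean \<open>m\<close>-space is Euclidean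
  \<open>(n + m)\<close>-space by concatenation of coordinates.\<close>

definition prod_chart :: "nat \<Rightarrow> 'a chart \<Rightarrow> 'b chart \<Rightarrow> ('a \<times> 'b) chart" where
  "prod_chart n c d =
     (fst c \<times> fst d, \<lambda>(x, y) i. if i < n then snd c x i else snd d y (i - n))"

definition prod_atlas :: "nat \<Rightarrow> 'a chart set \<Rightarrow> 'b chart set \<Rightarrow> ('a \<times> 'b) chart set" where
  "prod_atlas n A B = {prod_chart n c d |c d. c \<in> A \<and> d \<in> B}"

definition Lie_group :: "'g monoid \<Rightarrow> 'g topology \<Rightarrow> nat \<Rightarrow> 'g chart set \<Rightarrow> bool" where
  "Lie_group G T n A \<longleftrightarrow>
     Group.group G \<and> topspace T = carrier G \<and> smooth_manifold T n A \<and>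
     smooth_map (prod_topology T T) (n + n) (prod_atlas n A A) T n A (\<lambda>(g, h). g \<otimes>\<^bsub>G\<^esub> h) \<and>
     smooth_map T n A T n A (\<lambda>g. inv\<^bsub>G\<^esub> g)"

section \<open>G-spaces, G-maps and G-homotopies\<close>

text \<open>The library locale \<open>group_action\<close> is not used because it requires each \<open>\<alpha> g\<close> to
  be extensional on the carrier, which the formulas for restricted and diagonal actions are not.\<close>

definition G_space ::
  "('g, 'm) monoid_scheme \<Rightarrow> 'g topology \<Rightarrow> 'x topology \<Rightarrow> ('g \<Rightarrow> 'x \<Rightarrow> 'x) \<Rightarrow> bool" where
  "G_space G T X \<alpha> \<longleftrightarrow>
     Hausdorff_space X \<and>
     continuous_map (prod_topology T X) X (\<lambda>(g, x). \<alpha> g x) \<and>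
     (\<forall>x\<in>topspace X. \<alpha> \<one>\<^bsub>G\<^esub> x = x) \<and>
     (\<forall>g\<in>carrier G. \<forall>h\<in>carrier G. \<forall>x\<in>topspace X. \<alpha> (g \<otimes>\<^bsub>G\<^esub> h) x = \<alpha> g (\<alpha> h x))"

definition G_map ::
  "('g, 'm) monoid_scheme \<Rightarrow> 'x topology \<Rightarrow> ('g \<Rightarrow> 'x \<Rightarrow> 'x) \<Rightarrow> 'y topology \<Rightarrow> ('g \<Rightarrow> 'y \<Rightarrow> 'y) \<Rightarrow>
     ('x \<Rightarrow> 'y) \<Rightarrow> bool" where
  "G_map G X \<alpha> Y \<beta> f \<longleftrightarrow>
     continuous_map X Y f \<and> (\<forall>g\<in>carrier G. \<forall>x\<in>topspace X. f (\<alpha> g x) = \<beta> g (f x))"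

definition diag_action ::
  "('g \<Rightarrow> 'x \<Rightarrow> 'x) \<Rightarrow> ('g \<Rightarrow> 'y \<Rightarrow> 'y) \<Rightarrow> 'g \<Rightarrow> 'x \<times> 'y \<Rightarrow> 'x \<times> 'y" where
  "diag_action \<alpha> \<beta> g = map_prod (\<alpha> g) (\<beta> g)"

definition trivial_action :: "'g \<Rightarrow> 'x \<Rightarrow> 'x" where
  "trivial_action g x = x"

definition G_homotopic ::
  "('g, 'm) monoid_scheme \<Rightarrow> 'x topology \<Rightarrow> ('g \<Rightarrow> 'x \<Rightarrow> 'x) \<Rightarrow> 'y topology \<Rightarrow> ('g \<Rightarrow> 'y \<Rightarrow> 'y) \<Rightarrow>
     ('x \<Rightarrow> 'y) \<Rightarrow> ('x \<Rightarrow> 'y) \<Rightarrow> bool" where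
  "G_homotopic G X \<alpha> Y \<beta> u v \<longleftrightarrow>
     G_map G X \<alpha> Y \<beta> u \<and> G_map G X \<alpha> Y \<beta> v \<and>
     (\<exists>H. G_map G (prod_topology X (top_of_set {0..1::real})) (diag_action \<alpha> trivial_action) Y \<beta> H \<and>
          (\<forall>x\<in>topspace X. H (x, 0) = u x \<and> H (x, 1) = v x))"

definition G_invariant :: "('g, 'm) monoid_scheme \<Rightarrow> ('g \<Rightarrow> 'x \<Rightarrow> 'x) \<Rightarrow> 'x set \<Rightarrow> bool" where
  "G_invariant G \<alpha> U \<longleftrightarrow> (\<forall>g\<in>carrier G. \<alpha> g ` U \<subseteq> U)"

section \<open>Equivariant relative sectional category\<close>

text \<open>The infimum of the empty set in \<^typ>\<open>enat\<close> is \<open>\<infinity>\<close>. The actions on \<open>K\<close>, \<open>E\<close>, \<open>B\<close> are \<open>\<kappa>\<close>, \<open>\<epsilon>\<close>, \<open>\<beta>\<close>.\<close>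

definition secat_G ::
  "('g, 'm) monoid_scheme \<Rightarrow> 'k topology \<Rightarrow> ('g \<Rightarrow> 'k \<Rightarrow> 'k) \<Rightarrow> 'e topology \<Rightarrow> ('g \<Rightarrow> 'e \<Rightarrow> 'e) \<Rightarrow>
     'b topology \<Rightarrow> ('g \<Rightarrow> 'b \<Rightarrow> 'b) \<Rightarrow> ('k \<Rightarrow> 'b) \<Rightarrow> ('e \<Rightarrow> 'b) \<Rightarrow> enat" where
  "secat_G G K \<kappa> E \<epsilon> B \<beta> f p =
     Inf {enat n |n. \<exists>U s.
       (\<Union>i\<le>n. U i) = topspace K \<and>
       (\<forall>i\<le>n. openin K (U i) \<and> G_invariant G \<kappa> (U i) \<and>
          G_map G (subtopology K (U i)) \<kappa> E \<epsilon> (s i) \<and>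
          G_homotopic G (subtopology K (U i)) \<kappa> B \<beta> (p \<circ> s i) f)}"

end

theory Submission
  imports Defs
begin

text \<open>Taking products of the given local sections over \<open>U i \<times> V j\<close> produces
  \<open>(n1 + 1) * (n2 + 1)\<close> open sets, far too many. Grouping them by \<open>i + j\<close> would need separation
  properties of the product \<open>K1 \<times> K2\<close>, and these do not follow from those of the factors. All separation
  is therefore done inside each factor, by making its cover redundant: from an invariant
  open cover of \<open>K\<close> by \<open>n + 1\<close> sets with local sections, \<open>redundant_local_sections\<close> builds an infinite
  sequence of invariant open sets \<open>P k\<close>, each with a local section, such that every point of \<open>K\<close> lies
  outside at most \<open>n\<close> of them. Given such sequences for both factors, a point \<open>(x, y)\<close> lies outside at
  most \<open>n1 + n2\<close> of the sets \<open>P1 k \<times> P2 k\<close>, so \<open>n1 + n2 + 1\<close> of them cover the product.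

  The redundant sequence comes from level sets. Urysohn's lemma gives continuous functions
  \<open>l i\<close> with values in \<open>[0, 1]\<close>, vanishing off \<open>U i\<close>, one of which exceeds \<open>1/2\<close> at each point. Replacing
  \<open>l i\<close> by its supremum \<open>\<mu> i\<close> over orbits makes it invariant, and compactness of the group keeps it
  continuous. Choose distinct thresholds \<open>t k\<close> in \<open>(0, 1/2)\<close> and let \<open>P k\<close> consist of the points at
  which the first \<open>\<mu> i\<close> to reach \<open>t k\<close> exceeds it strictly. Sorting these points by that
  \<open>i\<close> splits \<open>P k\<close> into disjoint invariant open pieces inside the sets \<open>U i\<close>, over which the given sections and
  homotopies glue. A point outside \<open>P k\<close> has \<open>\<mu> i = t k\<close> for some \<open>i\<close>; each \<open>i\<close> accounts for at most one \<open>k\<close>,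
  and an \<open>i\<close> with \<open>\<mu> i > 1/2\<close> for none, which leaves at most \<open>n\<close> values of \<open>k\<close>.\<close>

section \<open>Invariant Urysohn functions\<close>

text \<open>The shrinking lemma for finite covers in functional form: the sets \<open>{x. l i x > 1/2}\<close> are a
  cover that refines \<open>U\<close> with the same index set. One \<open>U j\<close> after the other is replaced by such a
  set, and Urysohn's lemma separates the complement of \<open>U j\<close> from what the other sets leave uncovered.\<close>

lemma normal_space_finite_cover_functions:
  fixes U :: "nat \<Rightarrow> 'x set"
  assumes X: "normal_space X" and ope: "\<And>i. i < m \<Longrightarrow> openin X (U i)"
    and cov: "topspace X \<subseteq> (\<Union>i<m. U i)"
  obtains l :: "nat \<Rightarrow> 'x \<Rightarrow> real"
  where "\<And>i. i < m \<Longrightarrow> continuous_map X euclideanreal (l i)"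
    and "\<And>i x. \<lbrakk>i < m; x \<in> topspace X\<rbrakk> \<Longrightarrow> l i x \<in> {0..1}"
    and "\<And>i x. \<lbrakk>i < m; x \<in> topspace X; x \<notin> U i\<rbrakk> \<Longrightarrow> l i x = 0"
    and "\<And>x. x \<in> topspace X \<Longrightarrow> \<exists>i<m. l i x > 1/2"
proof -
  have "\<exists>l :: nat \<Rightarrow> 'x \<Rightarrow> real. (\<forall>i<j. continuous_map X euclideanreal (l i) \<and>
          (\<forall>x\<in>topspace X. l i x \<in> {0..1} \<and> (x \<notin> U i \<longrightarrow> l i x = 0))) \<and>
          (\<forall>x\<in>topspace X. (\<exists>i<j. l i x > 1/2) \<or> (\<exists>i\<in>{j..<m}. x \<in> U i))" if "j \<le> m" for j
    using that
  proof (induction j)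
    case 0
    then show ?case using cov by force
  next
    case (Suc j)
    then obtain l :: "nat \<Rightarrow> 'x \<Rightarrow> real" where
      l: "\<forall>i<j. continuous_map X euclideanreal (l i) \<and>
          (\<forall>x\<in>topspace X. l i x \<in> {0..1} \<and> (x \<notin> U i \<longrightarrow> l i x = 0))"
      and lcov: "\<forall>x\<in>topspace X. (\<exists>i<j. l i x > 1/2) \<or> (\<exists>i\<in>{j..<m}. x \<in> U i)"
      by force
    \<comment> \<open>The part that is covered without \<open>U j\<close>.\<close>
    define V where "V = (\<Union>i<j. {x \<in> topspace X. l i x > 1/2}) \<union> (\<Union>i\<in>{Suc j..<m}. U i)"
    have "openin X {x \<in> topspace X. l i x > 1/2}" if "i < j" for i
      using l that unfolding continuous_map_upper_lower_semicontinuous_lt by blast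
    then have "openin X V"
      unfolding V_def using ope by (intro openin_Un openin_Union) auto
    then have "closedin X (topspace X - V)" by blast
    moreover have "closedin X (topspace X - U j)"
      using Suc.prems by (intro closedin_diff closedin_topspace ope) simp
    moreover have "disjnt (topspace X - U j) (topspace X - V)"
    proof -
      have "x \<in> U j \<or> x \<in> V" if "x \<in> topspace X" for x
      proof -
        have "{j..<m} = insert j {Suc j..<m}" using Suc.prems by auto
        then show ?thesis using lcov that unfolding V_def by force
      qed
      then show ?thesis by (auto simp: disjnt_def)
    qed
    ultimately obtain h where h: "continuous_map X (top_of_set {0..1::real}) h"
      "h ` (topspace X - U j) \<subseteq> {0}" "h ` (topspace X - V) \<subseteq> {1}"
      using Urysohn_lemma[OF X, of "topspace X - U j" "topspace X - V" 0 1] by auto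
    have h': "continuous_map X euclideanreal h" "\<And>x. x \<in> topspace X \<Longrightarrow> h x \<in> {0..1}"
      using h(1) by (auto simp: continuous_map_in_subtopology)
    have "(\<exists>i<Suc j. (l(j := h)) i x > 1/2) \<or> (\<exists>i\<in>{Suc j..<m}. x \<in> U i)"
      if x: "x \<in> topspace X" for x
    proof (cases "x \<in> V")
      case True
      then show ?thesis unfolding V_def by (auto simp: less_Suc_eq)
    next
      case False
      then have "h x = 1" using h(3) x by auto
      then show ?thesis by auto
    qed
    moreover have "continuous_map X euclideanreal ((l(j := h)) i) \<and>
          (\<forall>x\<in>topspace X. (l(j := h)) i x \<in> {0..1} \<and> (x \<notin> U i \<longrightarrow> (l(j := h)) i x = 0))"
      if "i < Suc j" for i
    proof (cases "i = j")
      case True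
      then show ?thesis using h(2) h' by auto
    next
      case False
      then show ?thesis using l that by simp
    qed
    ultimately show ?case by blast
  qed
  then obtain l :: "nat \<Rightarrow> 'x \<Rightarrow> real" where
    l: "\<forall>i<m. continuous_map X euclideanreal (l i) \<and>
          (\<forall>x\<in>topspace X. l i x \<in> {0..1} \<and> (x \<notin> U i \<longrightarrow> l i x = 0))"
    and lcov: "\<forall>x\<in>topspace X. (\<exists>i<m. l i x > 1/2) \<or> (\<exists>i\<in>{m..<m}. x \<in> U i)"
    by blast
  show thesis by (rule that[of l]) (use l lcov in auto)
qed

lemma G_space_closed:
  assumes "G_space G T X \<alpha>" "topspace T = carrier G" "g \<in> carrier G" "x \<in> topspace X"
  shows "\<alpha> g x \<in> topspace X"
proof -
  have "(\<lambda>(g, x). \<alpha> g x) \<in> topspace (prod_topology T X) \<rightarrow> topspace X"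
    using assms(1) unfolding G_space_def by (intro continuous_map_funspace) blast
  from funcset_mem[OF this, of "(g, x)"] show ?thesis using assms(2-4) by simp
qed

text \<open>The supremum is lower semicontinuous for every group, being a supremum of continuous functions.
  Upper semicontinuity is where compactness enters: if \<open>h < b\<close> on the orbit of \<open>x\<close>, the tube lemma
  gives \<open>h < b\<close> on the orbits of all points near \<open>x\<close>.\<close>

lemma orbit_supremum:
  fixes G (structure) and h :: "'x \<Rightarrow> real"
  assumes G: "Group.group G" and T: "topspace T = carrier G" and compT: "compact_space T"
    and X: "G_space G T X \<alpha>"
    and h: "continuous_map X euclideanreal h" "\<And>x. x \<in> topspace X \<Longrightarrow> h x \<in> {0..1}"
  defines "h' \<equiv> \<lambda>x. SUP g\<in>carrier G. h (\<alpha> g x)"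
  shows orbit_supremum_greater:
      "\<And>x t. x \<in> topspace X \<Longrightarrow> h' x > t \<longleftrightarrow> (\<exists>g\<in>carrier G. h (\<alpha> g x) > t)"
    and orbit_supremum_continuous: "continuous_map X euclideanreal h'"
    and orbit_supremum_invariant:
      "\<And>g x. \<lbrakk>g \<in> carrier G; x \<in> topspace X\<rbrakk> \<Longrightarrow> h' (\<alpha> g x) = h' x"
proof -
  interpret Group.group G by (rule G)
  have act: "\<alpha> g x \<in> topspace X" if "g \<in> carrier G" "x \<in> topspace X" for g x
    using G_space_closed[OF X T that] .
  have bdd: "bdd_above ((\<lambda>g. h (\<alpha> g x)) ` carrier G)" if "x \<in> topspace X" for x
    using h(2) act that by (intro bdd_aboveI2[where M=1]) auto
  have ne: "carrier G \<noteq> {}" by auto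
  show greater: "h' x > t \<longleftrightarrow> (\<exists>g\<in>carrier G. h (\<alpha> g x) > t)" if "x \<in> topspace X" for x t
    unfolding h'_def using less_cSUP_iff[OF ne bdd[OF that]] .
  have cont: "continuous_map (prod_topology T X) euclideanreal (\<lambda>(g, x). h (\<alpha> g x))"
    using continuous_map_compose[OF _ h(1), of "prod_topology T X" "\<lambda>(g, x). \<alpha> g x"] X
    unfolding G_space_def o_def by (simp add: case_prod_unfold)
  show "continuous_map X euclideanreal h'"
    unfolding continuous_map_upper_lower_semicontinuous_lt
  proof (intro conjI allI)
    fix a
    have "{x \<in> topspace X. a < h' x} = (\<Union>g\<in>carrier G. {x \<in> topspace X. a < h (\<alpha> g x)})"
      using greater by auto
    moreover have "openin X {x \<in> topspace X. a < h (\<alpha> g x)}" if g: "g \<in> carrier G" for g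
    proof -
      have "continuous_map X (prod_topology T X) (\<lambda>x. (g, x))"
        using g T by (simp add: continuous_map_pairwise o_def)
      from continuous_map_compose[OF this cont] show ?thesis
        by (simp add: o_def continuous_map_upper_lower_semicontinuous_lt)
    qed
    ultimately show "openin X {x \<in> topspace X. a < h' x}" by auto
  next
    fix a
    show "openin X {x \<in> topspace X. h' x < a}"
    proof (subst openin_subopen, intro ballI)
      fix x assume "x \<in> {x \<in> topspace X. h' x < a}"
      then have x: "x \<in> topspace X" "h' x < a" by auto
      \<comment> \<open>The tube lemma gives \<open>h < b\<close> on nearby orbits, hence only \<open>h' \<le> b\<close>; so \<open>b\<close> is chosen below \<open>a\<close>.\<close>
      then obtain b where b: "h' x < b" "b < a" using dense by blast
      define W where "W = {z \<in> topspace (prod_topology T X). (\<lambda>(g, x). h (\<alpha> g x)) z < b}"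
      have W: "openin (prod_topology T X) W"
        using cont unfolding W_def continuous_map_upper_lower_semicontinuous_lt by blast
      have "topspace T \<times> {x} \<subseteq> W"
        using x b greater[OF x(1), of b] unfolding W_def T
        by (auto simp: T) (smt (verit) cSUP_upper bdd h'_def)
      then obtain U V where UV: "openin X V" "x \<in> V" "topspace T \<times> V \<subseteq> W"
        using tube_lemma_left[OF W _ x(1), of "topspace T"] compT
        unfolding compact_space_def by (meson Sigma_mono dual_order.trans order_refl)
      have "h' y < a" if "y \<in> V" for y
      proof -
        have "h (\<alpha> g y) \<le> b" if "g \<in> carrier G" for g
          using UV(3) \<open>y \<in> V\<close> that unfolding W_def T by force
        then have "h' y \<le> b" unfolding h'_def by (intro cSUP_least ne)
        then show ?thesis using b by simp
      qed
      then show "\<exists>S. openin X S \<and> x \<in> S \<and> S \<subseteq> {x \<in> topspace X. h' x < a}"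
        using UV openin_subset by blast
    qed
  qed
  show "h' (\<alpha> g x) = h' x" if g: "g \<in> carrier G" and x: "x \<in> topspace X" for g x
  proof -
    have "h (\<alpha> k (\<alpha> g x)) = h (\<alpha> (k \<otimes> g) x)" if "k \<in> carrier G" for k
      using X g x that unfolding G_space_def by simp
    then have "(\<lambda>k. h (\<alpha> k (\<alpha> g x))) ` carrier G = (\<lambda>k. h (\<alpha> k x)) ` ((\<lambda>k. k \<otimes> g) ` carrier G)"
      by (auto simp: image_image)
    also have "(\<lambda>k. k \<otimes> g) ` carrier G = carrier G"
    proof
      show "carrier G \<subseteq> (\<lambda>k. k \<otimes> g) ` carrier G"
      proof
        fix k assume "k \<in> carrier G"
        then show "k \<in> (\<lambda>k. k \<otimes> g) ` carrier G"
          using g by (intro image_eqI[of _ _ "k \<otimes> inv g"]) (simp_all add: m_assoc)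
      qed
    qed (use g in auto)
    finally show ?thesis unfolding h'_def by simp
  qed
qed


section \<open>Covers that miss each point boundedly often\<close>

text \<open>Ordering the sets of the cover turns each threshold into a disjoint refinement which
  misses only the points where some function equals the threshold. As distinct thresholds compete
  for the at most \<open>n + 1\<close> values at a point, and one of these values is too large to be hit, a point is
  missed at most \<open>n\<close> times. Finiteness is stated separately because the cardinality of an infinite
  set is \<open>0\<close>.\<close>

lemma redundant_disjoint_refinement:
  fixes G (structure) and U :: "nat \<Rightarrow> 'x set"
  assumes G: "Group.group G" and T: "topspace T = carrier G" and compT: "compact_space T"
    and X: "G_space G T X \<alpha>" and norm: "normal_space X"
    and ope: "\<And>i. i \<le> n \<Longrightarrow> openin X (U i)" and inv: "\<And>i. i \<le> n \<Longrightarrow> G_invariant G \<alpha> (U i)"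
    and cov: "topspace X \<subseteq> (\<Union>i\<le>n. U i)"
  obtains P :: "nat \<Rightarrow> nat \<Rightarrow> 'x set"
  where "\<And>k i. i \<le> n \<Longrightarrow> openin X (P k i) \<and> G_invariant G \<alpha> (P k i) \<and> P k i \<subseteq> U i"
    and "\<And>k. disjoint_family_on (P k) {..n}"
    and "\<And>x. x \<in> topspace X \<Longrightarrow>
           finite {k. x \<notin> (\<Union>i\<le>n. P k i)} \<and> card {k. x \<notin> (\<Union>i\<le>n. P k i)} \<le> n"
proof -
  interpret Group.group G by (rule G)
  obtain l :: "nat \<Rightarrow> 'x \<Rightarrow> real" where
    l: "\<And>i. i \<le> n \<Longrightarrow> continuous_map X euclideanreal (l i)"
       "\<And>i x. \<lbrakk>i \<le> n; x \<in> topspace X\<rbrakk> \<Longrightarrow> l i x \<in> {0..1}"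
    and l0: "\<And>i x. \<lbrakk>i \<le> n; x \<in> topspace X; x \<notin> U i\<rbrakk> \<Longrightarrow> l i x = 0"
    and l1: "\<And>x. x \<in> topspace X \<Longrightarrow> \<exists>i\<le>n. l i x > 1/2"
    using normal_space_finite_cover_functions[OF norm, of "Suc n" U] ope cov
    unfolding less_Suc_eq_le lessThan_Suc_atMost by blast
  define \<mu> where "\<mu> i x = (SUP g\<in>carrier G. l i (\<alpha> g x))" for i x
  have \<mu>_cont: "continuous_map X euclideanreal (\<mu> i)" if "i \<le> n" for i
    using orbit_supremum_continuous[OF G T compT X l(1)[OF that] l(2)[OF that]] unfolding \<mu>_def .
  have \<mu>_greater: "\<mu> i x > t \<longleftrightarrow> (\<exists>g\<in>carrier G. l i (\<alpha> g x) > t)"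
    and \<mu>_inv: "g \<in> carrier G \<Longrightarrow> \<mu> i (\<alpha> g x) = \<mu> i x"
    if "i \<le> n" "x \<in> topspace X" for i x t g
    using orbit_supremum[OF G T compT X l(1)[OF that(1)] l(2)[OF that(1)]] that(2)
    unfolding \<mu>_def by blast+
  have \<mu>1: "\<exists>i\<le>n. \<mu> i x > 1/2" if x: "x \<in> topspace X" for x
  proof -
    obtain i where "i \<le> n" "l i x > 1/2" using l1 x by blast
    moreover have "\<alpha> \<one> x = x" using X x unfolding G_space_def by simp
    ultimately have "\<mu> i x > 1/2" using \<mu>_greater x one_closed by force
    with \<open>i \<le> n\<close> show ?thesis by blast
  qed
  have \<mu>U: "x \<in> U i" if i: "i \<le> n" and x: "x \<in> topspace X" and pos: "\<mu> i x > 0" for i x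
  proof -
    obtain g where g: "g \<in> carrier G" "l i (\<alpha> g x) > 0"
      using pos \<mu>_greater[OF i x, of 0] by blast
    then have "\<alpha> g x \<in> U i"
      using l0[OF i G_space_closed[OF X T g(1) x]] by force
    then have "\<alpha> (inv g) (\<alpha> g x) \<in> U i"
      using inv[OF i] g unfolding G_invariant_def by blast
    moreover have "\<alpha> (inv g) (\<alpha> g x) = x"
      using X x g unfolding G_space_def by (metis inv_closed l_inv)
    ultimately show ?thesis by simp
  qed
  \<comment> \<open>Any injective sequence in \<open>(0, 1/2)\<close> would do.\<close>
  define t :: "nat \<Rightarrow> real" where "t k = 1 / (real k + 3)" for k
  have t: "0 < t k" "t k < 1/2" for k by (auto simp: t_def field_simps)
  have "inj t" by (auto simp: t_def inj_on_def)
  define P where "P k i = {x \<in> topspace X. \<mu> i x > t k \<and> (\<forall>j<i. \<mu> j x < t k)}" for k i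
  show thesis
  proof
    fix k i assume i: "i \<le> n"
    have "P k i = {x \<in> topspace X. \<mu> i x > t k} \<inter> (topspace X \<inter> (\<Inter>j<i. {x \<in> topspace X. \<mu> j x < t k}))"
      by (auto simp: P_def)
    moreover have "openin X (topspace X \<inter> (\<Inter>j<i. {x \<in> topspace X. \<mu> j x < t k}))"
    \<comment> \<open>For \<open>i = 0\<close> the intersection over \<open>j < i\<close> is the whole type.\<close>
    proof (cases "i = 0")
      case False
      then show ?thesis
        using i \<mu>_cont[unfolded continuous_map_upper_lower_semicontinuous_lt]
        by (intro openin_Int openin_INT2) auto
    qed simp
    ultimately have "openin X (P k i)"
      using i \<mu>_cont[unfolded continuous_map_upper_lower_semicontinuous_lt] by auto
    moreover have "P k i \<subseteq> U i"
      using \<mu>U[OF i] t(1)[of k] unfolding P_def by (auto dest: order.strict_trans)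
    moreover have "G_invariant G \<alpha> (P k i)"
      unfolding G_invariant_def P_def using i \<mu>_inv G_space_closed[OF X T] by auto
    ultimately show "openin X (P k i) \<and> G_invariant G \<alpha> (P k i) \<and> P k i \<subseteq> U i" by blast
  next
    fix k
    show "disjoint_family_on (P k) {..n}"
      unfolding disjoint_family_on_def P_def by (auto, metis less_asym linorder_neqE_nat)
  next
    fix x assume x: "x \<in> topspace X"
    define M where "M = {k. x \<notin> (\<Union>i\<le>n. P k i)}"
    obtain i0 where i0: "i0 \<le> n" "\<mu> i0 x > 1/2" using \<mu>1[OF x] by blast
    have "t ` M \<subseteq> (\<lambda>i. \<mu> i x) ` ({..n} - {i0})"
    proof (rule image_subsetI)
      fix k assume k: "k \<in> M"
      define i where "i = (LEAST i. \<mu> i x \<ge> t k)"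
      have ge0: "\<mu> i0 x \<ge> t k" using i0 t(2)[of k] by simp
      have ge: "\<mu> i x \<ge> t k" unfolding i_def using ge0 by (rule LeastI)
      have "i \<le> i0" unfolding i_def using ge0 by (rule Least_le)
      then have "i \<le> n" using i0 by simp
      moreover have "\<mu> j x < t k" if "j < i" for j
        using not_less_Least[of j "\<lambda>i. \<mu> i x \<ge> t k"] that unfolding i_def by simp
      moreover have "x \<notin> P k i" using k \<open>i \<le> n\<close> unfolding M_def by blast
      ultimately have "\<not> \<mu> i x > t k" using x unfolding P_def by blast
      with ge have "\<mu> i x = t k" by simp
      moreover from this have "i \<noteq> i0" using i0 t(2)[of k] by auto
      ultimately show "t k \<in> (\<lambda>i. \<mu> i x) ` ({..n} - {i0})" using \<open>i \<le> n\<close> by force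
    qed
    then have "finite (t ` M)" "card (t ` M) \<le> card ({..n} - {i0})"
      using finite_surj[of "{..n} - {i0}"] surj_card_le[of "{..n} - {i0}"] by simp_all
    moreover have "inj_on t M" using \<open>inj t\<close> by (rule inj_on_subset) simp
    moreover have "card ({..n} - {i0}) = n" using i0 by simp
    ultimately show "finite {k. x \<notin> (\<Union>i\<le>n. P k i)} \<and> card {k. x \<notin> (\<Union>i\<le>n. P k i)} \<le> n"
      unfolding M_def[symmetric] by (simp only: finite_image_iff card_image)
  qed
qed

section \<open>Local sections up to equivariant homotopy\<close>

text \<open>The condition that the sectional category imposes on each member of a cover, together with
  its witness \<open>s\<close>.\<close>

definition local_section ::
  "('g, 'm) monoid_scheme \<Rightarrow> 'k topology \<Rightarrow> ('g \<Rightarrow> 'k \<Rightarrow> 'k) \<Rightarrow> 'e topology \<Rightarrow> ('g \<Rightarrow> 'e \<Rightarrow> 'e) \<Rightarrow>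
     'b topology \<Rightarrow> ('g \<Rightarrow> 'b \<Rightarrow> 'b) \<Rightarrow> ('k \<Rightarrow> 'b) \<Rightarrow> ('e \<Rightarrow> 'b) \<Rightarrow> 'k set \<Rightarrow> ('k \<Rightarrow> 'e) \<Rightarrow> bool" where
  "local_section G K \<kappa> E \<epsilon> B \<beta> f p U s \<longleftrightarrow>
     openin K U \<and> G_invariant G \<kappa> U \<and> G_map G (subtopology K U) \<kappa> E \<epsilon> s \<and>
     G_homotopic G (subtopology K U) \<kappa> B \<beta> (p \<circ> s) f"

lemma G_map_subtopology_mono:
  assumes "G_map G (subtopology X U) \<alpha> Y \<beta> h" "V \<subseteq> U"
  shows "G_map G (subtopology X V) \<alpha> Y \<beta> h"
  using assms continuous_map_from_subtopology_mono unfolding G_map_def by fastforce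

lemma G_map_pasting:
  assumes ope: "\<And>i. i \<in> I \<Longrightarrow> openin X (W i)" and inv: "\<And>i. i \<in> I \<Longrightarrow> G_invariant G \<alpha> (W i)"
    and cov: "topspace X \<subseteq> (\<Union>i\<in>I. W i)" and dis: "disjoint_family_on W I"
    and h: "\<And>i. i \<in> I \<Longrightarrow> G_map G (subtopology X (W i)) \<alpha> Y \<beta> (h i)"
  obtains h' where "G_map G X \<alpha> Y \<beta> h'" "\<And>i x. \<lbrakk>i \<in> I; x \<in> W i\<rbrakk> \<Longrightarrow> h' x = h i x"
proof -
  obtain h' where cont: "continuous_map X Y h'"
    and eq: "\<And>x i. \<lbrakk>i \<in> I; x \<in> topspace X \<inter> W i\<rbrakk> \<Longrightarrow> h' x = h i x"
  proof (rule pasting_lemma_exists[OF cov ope])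
    show "continuous_map (subtopology X (W i)) Y (h i)" if "i \<in> I" for i
      using h[OF that] unfolding G_map_def by blast
    show "h i x = h j x" if "i \<in> I" "j \<in> I" "x \<in> topspace X \<inter> W i \<inter> W j" for i j x
      using dis that unfolding disjoint_family_on_def by (cases "i = j") auto
  qed auto
  have sub: "W i \<subseteq> topspace X" if "i \<in> I" for i using ope[OF that] openin_subset by blast
  have eq': "h' x = h i x" if "i \<in> I" "x \<in> W i" for i x using eq sub that by blast
  have "h' (\<alpha> g x) = \<beta> g (h' x)" if g: "g \<in> carrier G" and x: "x \<in> topspace X" for g x
  proof -
    obtain i where i: "i \<in> I" "x \<in> W i" using cov x by blast
    then have "\<alpha> g x \<in> W i" using inv g unfolding G_invariant_def by blast
    then show ?thesis using h[OF i(1)] eq' i g x unfolding G_map_def by simp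
  qed
  with cont have "G_map G X \<alpha> Y \<beta> h'" unfolding G_map_def by blast
  with eq' show thesis using that by blast
qed

lemma local_section_mono:
  assumes s: "local_section G K \<kappa> E \<epsilon> B \<beta> f p U s"
    and V: "openin K V" "G_invariant G \<kappa> V" "V \<subseteq> U"
  shows "local_section G K \<kappa> E \<epsilon> B \<beta> f p V s"
proof -
  have sub: "G_map G (subtopology K V) \<kappa> Y \<gamma> h" if "G_map G (subtopology K U) \<kappa> Y \<gamma> h" for Y \<gamma> h
    using G_map_subtopology_mono[OF that V(3)] .
  obtain H where H: "G_map G (prod_topology (subtopology K U) (top_of_set {0..1::real}))
        (diag_action \<kappa> trivial_action) B \<beta> H"
      "\<forall>x\<in>topspace (subtopology K U). H (x, 0) = (p \<circ> s) x \<and> H (x, 1) = f x"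
    using s unfolding local_section_def G_homotopic_def by blast
  have "G_map G (prod_topology (subtopology K V) (top_of_set {0..1::real}))
        (diag_action \<kappa> trivial_action) B \<beta> H"
    using G_map_subtopology_mono[of G "prod_topology K (top_of_set {0..1::real})" "U \<times> UNIV"
        _ B \<beta> H "V \<times> UNIV"] H(1) V(3) by (auto simp: subtopology_Times)
  moreover have "\<forall>x\<in>topspace (subtopology K V). H (x, 0) = (p \<circ> s) x \<and> H (x, 1) = f x"
    using H(2) V(3) by auto
  moreover have "G_map G (subtopology K V) \<kappa> E \<epsilon> s" "G_map G (subtopology K V) \<kappa> B \<beta> (p \<circ> s)"
    "G_map G (subtopology K V) \<kappa> B \<beta> f"
    using s sub unfolding local_section_def G_homotopic_def by blast+
  ultimately show ?thesis
    using V unfolding local_section_def G_homotopic_def by blast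
qed

text \<open>Disjointness makes the pasting conditions vacuous, for the sections and, on the cylinders
  \<open>W i \<times> [0, 1]\<close>, for the homotopies.\<close>

lemma local_section_disjoint_union:
  assumes s: "\<And>i. i \<in> I \<Longrightarrow> local_section G K \<kappa> E \<epsilon> B \<beta> f p (W i) (s i)"
    and dis: "disjoint_family_on W I"
    and f: "G_map G K \<kappa> B \<beta> f" and p: "G_map G E \<epsilon> B \<beta> p"
  obtains s' where "local_section G K \<kappa> E \<epsilon> B \<beta> f p (\<Union>i\<in>I. W i) s'"
proof -
  define U where "U = (\<Union>i\<in>I. W i)"
  have W: "openin K (W i)" "G_invariant G \<kappa> (W i)" "W i \<subseteq> U" "W i \<subseteq> topspace K" if "i \<in> I" for i
    using s[OF that] that openin_subset unfolding local_section_def U_def by blast+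
  have U: "openin K U" unfolding U_def using W(1) by blast
  have invU: "G_invariant G \<kappa> U" using W(2) unfolding U_def G_invariant_def by blast
  have subW: "subtopology (subtopology K U) (W i) = subtopology K (W i)" if "i \<in> I" for i
    using W(3)[OF that] by (simp add: subtopology_subtopology Int_absorb1)
  have opeW: "openin (subtopology K U) (W i)" if "i \<in> I" for i
    using W(1,3)[OF that] U by (simp add: openin_open_subtopology)
  obtain s' where s': "G_map G (subtopology K U) \<kappa> E \<epsilon> s'" "\<And>i x. \<lbrakk>i \<in> I; x \<in> W i\<rbrakk> \<Longrightarrow> s' x = s i x"
  proof (rule G_map_pasting[of I "subtopology K U" W G \<kappa> E \<epsilon> s])
    show "G_map G (subtopology (subtopology K U) (W i)) \<kappa> E \<epsilon> (s i)" if "i \<in> I" for i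
      using s[OF that] unfolding local_section_def subW[OF that] by blast
  qed (use opeW W dis in \<open>auto simp: U_def\<close>)
  let ?I = "top_of_set {0..1::real}" and ?\<delta> = "diag_action \<kappa> trivial_action"
  have "\<forall>i\<in>I. \<exists>H. G_map G (prod_topology (subtopology K (W i)) ?I) ?\<delta> B \<beta> H \<and>
      (\<forall>x\<in>topspace (subtopology K (W i)). H (x, 0) = (p \<circ> s i) x \<and> H (x, 1) = f x)"
    using s unfolding local_section_def G_homotopic_def by blast
  then obtain H where H: "\<And>i. i \<in> I \<Longrightarrow> G_map G (prod_topology (subtopology K (W i)) ?I) ?\<delta> B \<beta> (H i)"
    and H01: "\<And>i x. \<lbrakk>i \<in> I; x \<in> W i\<rbrakk> \<Longrightarrow> H i (x, 0) = p (s i x) \<and> H i (x, 1) = f x"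
    using W(4) by (auto dest!: bchoice) blast
  obtain H' where H': "G_map G (prod_topology (subtopology K U) ?I) ?\<delta> B \<beta> H'"
    and H'eq: "\<And>i z. \<lbrakk>i \<in> I; z \<in> W i \<times> {0..1}\<rbrakk> \<Longrightarrow> H' z = H i z"
  proof (rule G_map_pasting[of I "prod_topology (subtopology K U) ?I" "\<lambda>i. W i \<times> {0..1}" G ?\<delta> B \<beta> H])
    show "openin (prod_topology (subtopology K U) ?I) (W i \<times> {0..1})" if "i \<in> I" for i
      using opeW[OF that] by (simp add: openin_prod_Times_iff)
    show "G_invariant G ?\<delta> (W i \<times> {0..1})" if "i \<in> I" for i
      using W(2)[OF that] by (auto simp: G_invariant_def diag_action_def trivial_action_def)
    show "disjoint_family_on (\<lambda>i. W i \<times> {0..1::real}) I"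
      using dis by (auto simp: disjoint_family_on_def)
    show "G_map G (subtopology (prod_topology (subtopology K U) ?I) (W i \<times> {0..1})) ?\<delta> B \<beta> (H i)"
      if "i \<in> I" for i
      using H[OF that] unfolding subtopology_Times subW[OF that]
      by (simp add: subtopology_subtopology)
  qed (auto simp: U_def)
  have "\<forall>x\<in>topspace (subtopology K U). H' (x, 0) = (p \<circ> s') x \<and> H' (x, 1) = f x"
    using H'eq H01 s'(2) by (auto simp: U_def)
  moreover have "G_map G (subtopology K U) \<kappa> B \<beta> (p \<circ> s')"
    using s'(1) p continuous_map_compose continuous_map_funspace unfolding G_map_def o_apply
    by (fastforce simp: Pi_iff)
  moreover have "G_map G (subtopology K U) \<kappa> B \<beta> f"
    using f by (auto simp: G_map_def continuous_map_from_subtopology)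
  ultimately show thesis
    using that s'(1) H' U invU unfolding local_section_def G_homotopic_def U_def[symmetric] by blast
qed

text \<open>The sectional category counts the sets of a cover. This lemma trades that count for the number
  of times a point may be missed, which, unlike the number of sets, is additive under products.\<close>

lemma redundant_local_sections:
  assumes G: "Group.group G" and T: "topspace T = carrier G" and compT: "compact_space T"
    and K: "G_space G T K \<kappa>" and norm: "normal_space K"
    and f: "G_map G K \<kappa> B \<beta> f" and p: "G_map G E \<epsilon> B \<beta> p"
    and s: "\<And>i. i \<le> n \<Longrightarrow> local_section G K \<kappa> E \<epsilon> B \<beta> f p (U i) (s i)"
    and cov: "topspace K \<subseteq> (\<Union>i\<le>n. U i)"
  obtains P :: "nat \<Rightarrow> 'k set" and \<sigma>
  where "\<And>k. local_section G K \<kappa> E \<epsilon> B \<beta> f p (P k) (\<sigma> k)"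
    and "\<And>x. x \<in> topspace K \<Longrightarrow> finite {k. x \<notin> P k} \<and> card {k. x \<notin> P k} \<le> n"
proof -
  have U: "\<And>i. i \<le> n \<Longrightarrow> openin K (U i)" "\<And>i. i \<le> n \<Longrightarrow> G_invariant G \<kappa> (U i)"
    using s unfolding local_section_def by blast+
  obtain P :: "nat \<Rightarrow> nat \<Rightarrow> 'k set" where
    P: "\<And>k i. i \<le> n \<Longrightarrow> openin K (P k i) \<and> G_invariant G \<kappa> (P k i) \<and> P k i \<subseteq> U i"
    and dis: "\<And>k. disjoint_family_on (P k) {..n}"
    and card: "\<And>x. x \<in> topspace K \<Longrightarrow>
           finite {k. x \<notin> (\<Union>i\<le>n. P k i)} \<and> card {k. x \<notin> (\<Union>i\<le>n. P k i)} \<le> n"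
    using redundant_disjoint_refinement[OF G T compT K norm U cov] by metis
  have "\<exists>\<sigma>. local_section G K \<kappa> E \<epsilon> B \<beta> f p (\<Union>i\<le>n. P k i) \<sigma>" for k
  proof (rule local_section_disjoint_union[OF _ dis f p])
    show "local_section G K \<kappa> E \<epsilon> B \<beta> f p (P k i) (s i)" if "i \<in> {..n}" for i
      using local_section_mono[OF s] P that by (meson atMost_iff)
  qed blast
  then obtain \<sigma> where \<sigma>: "\<And>k. local_section G K \<kappa> E \<epsilon> B \<beta> f p (\<Union>i\<le>n. P k i) (\<sigma> k)"
    by metis
  show thesis by (rule that[OF \<sigma> card])
qed

section \<open>Products\<close>

lemma G_space_prod:
  assumes "G_space G T X \<alpha>" "G_space G T Y \<beta>"
  shows "G_space G T (prod_topology X Y) (diag_action \<alpha> \<beta>)"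
proof -
  let ?P = "prod_topology T (prod_topology X Y)"
  have "continuous_map ?P (prod_topology T X) (\<lambda>z. (fst z, fst (snd z)))"
    "continuous_map ?P (prod_topology T Y) (\<lambda>z. (fst z, snd (snd z)))"
    by (auto simp: continuous_map_pairwise o_def intro: continuous_map_fst
        continuous_map_compose[OF continuous_map_snd continuous_map_fst, unfolded o_def]
        continuous_map_compose[OF continuous_map_snd continuous_map_snd, unfolded o_def])
  from this[THEN continuous_map_compose] assms
  have "continuous_map ?P X (\<lambda>z. \<alpha> (fst z) (fst (snd z)))"
    "continuous_map ?P Y (\<lambda>z. \<beta> (fst z) (snd (snd z)))"
    unfolding G_space_def by (fastforce simp: o_def)+
  then have "continuous_map ?P (prod_topology X Y) (\<lambda>(g, z). diag_action \<alpha> \<beta> g z)"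
    by (simp add: diag_action_def map_prod_def case_prod_unfold continuous_map_paired)
  with assms show ?thesis
    unfolding G_space_def
    by (intro conjI) (simp_all add: Hausdorff_space_prod_topology, auto simp: diag_action_def)
qed

lemma G_map_prod:
  assumes "G_map G X \<alpha> X' \<alpha>' u" "G_map G Y \<beta> Y' \<beta>' v"
  shows "G_map G (prod_topology X Y) (diag_action \<alpha> \<beta>) (prod_topology X' Y') (diag_action \<alpha>' \<beta>')
           (map_prod u v)"
proof -
  have "continuous_map (prod_topology X Y) (prod_topology X' Y') (map_prod u v)"
    using assms unfolding G_map_def map_prod_def by (simp add: continuous_map_prod_top)
  moreover have "u (\<alpha> g x) = \<alpha>' g (u x)" "v (\<beta> g y) = \<beta>' g (v y)"
    if "g \<in> carrier G" "x \<in> topspace X" "y \<in> topspace Y" for g x y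
    using assms that unfolding G_map_def by blast+
  ultimately show ?thesis
    unfolding G_map_def topspace_prod_topology diag_action_def by auto
qed

lemma G_homotopic_prod:
  assumes "G_homotopic G X \<alpha> X' \<alpha>' u u'" "G_homotopic G Y \<beta> Y' \<beta>' v v'"
  shows "G_homotopic G (prod_topology X Y) (diag_action \<alpha> \<beta>) (prod_topology X' Y') (diag_action \<alpha>' \<beta>')
           (map_prod u v) (map_prod u' v')"
proof -
  let ?I = "top_of_set {0..1::real}"
  obtain H where H: "G_map G (prod_topology X ?I) (diag_action \<alpha> trivial_action) X' \<alpha>' H"
    "\<forall>x\<in>topspace X. H (x, 0) = u x \<and> H (x, 1) = u' x"
    using assms(1) unfolding G_homotopic_def by blast
  obtain J where J: "G_map G (prod_topology Y ?I) (diag_action \<beta> trivial_action) Y' \<beta>' J"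
    "\<forall>y\<in>topspace Y. J (y, 0) = v y \<and> J (y, 1) = v' y"
    using assms(2) unfolding G_homotopic_def by blast
  define L where "L z = (H (fst (fst z), snd z), J (snd (fst z), snd z))" for z
  let ?P = "prod_topology (prod_topology X Y) ?I"
  have "continuous_map ?P (prod_topology X ?I) (\<lambda>z. (fst (fst z), snd z))"
    "continuous_map ?P (prod_topology Y ?I) (\<lambda>z. (snd (fst z), snd z))"
    by (auto simp: continuous_map_pairwise o_def intro: continuous_map_snd
        continuous_map_compose[OF continuous_map_fst continuous_map_fst, unfolded o_def]
        continuous_map_compose[OF continuous_map_fst continuous_map_snd, unfolded o_def])
  from this[THEN continuous_map_compose] H(1) J(1)
  have "continuous_map ?P (prod_topology X' Y') L"
    unfolding G_map_def L_def by (fastforce simp: o_def continuous_map_paired)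
  moreover have "L (diag_action (diag_action \<alpha> \<beta>) trivial_action g z) = diag_action \<alpha>' \<beta>' g (L z)"
    if "g \<in> carrier G" "z \<in> topspace ?P" for g z
    using that H(1) J(1) unfolding G_map_def L_def diag_action_def trivial_action_def by fastforce
  ultimately have "G_map G ?P (diag_action (diag_action \<alpha> \<beta>) trivial_action)
      (prod_topology X' Y') (diag_action \<alpha>' \<beta>') L"
    unfolding G_map_def by blast
  moreover have "\<forall>z\<in>topspace (prod_topology X Y). L (z, 0) = map_prod u v z \<and> L (z, 1) = map_prod u' v' z"
    using H(2) J(2) by (auto simp: L_def)
  ultimately show ?thesis
    using assms G_map_prod unfolding G_homotopic_def by blast
qed

lemma local_section_prod:
  assumes "local_section G K1 \<kappa>1 E1 \<epsilon>1 B1 \<beta>1 f1 p1 U1 s1"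
    and "local_section G K2 \<kappa>2 E2 \<epsilon>2 B2 \<beta>2 f2 p2 U2 s2"
  shows "local_section G (prod_topology K1 K2) (diag_action \<kappa>1 \<kappa>2)
      (prod_topology E1 E2) (diag_action \<epsilon>1 \<epsilon>2) (prod_topology B1 B2) (diag_action \<beta>1 \<beta>2)
      (map_prod f1 f2) (map_prod p1 p2) (U1 \<times> U2) (map_prod s1 s2)"
proof -
  have "G_invariant G (diag_action \<kappa>1 \<kappa>2) (U1 \<times> U2)"
    using assms unfolding local_section_def G_invariant_def diag_action_def by fastforce
  moreover have "openin (prod_topology K1 K2) (U1 \<times> U2)"
    using assms unfolding local_section_def by (simp add: openin_prod_Times_iff)
  moreover note assms[unfolded local_section_def]
  ultimately show ?thesis
    unfolding local_section_def subtopology_Times map_prod.comp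
    by (intro conjI G_map_prod G_homotopic_prod) simp_all
qed

section \<open>Subadditivity of the sectional category\<close>

text \<open>A finite bound is witnessed by an actual cover because an infimum in a well-order is attained.
  The cover may have fewer sets than the bound permits, hence the \<open>m \<le> n\<close>.\<close>

lemma secat_G_le_iff:
  "secat_G G K \<kappa> E \<epsilon> B \<beta> f p \<le> enat n \<longleftrightarrow> (\<exists>m\<le>n. \<exists>U s. (\<Union>i\<le>m. U i) = topspace K \<and>
     (\<forall>i\<le>m. local_section G K \<kappa> E \<epsilon> B \<beta> f p (U i) (s i)))"
  (is "_ \<longleftrightarrow> (\<exists>m\<le>n. ?P m)")
proof -
  have eq: "secat_G G K \<kappa> E \<epsilon> B \<beta> f p = Inf (enat ` Collect ?P)"
    unfolding secat_G_def local_section_def by (rule arg_cong[where f=Inf]) auto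
  show ?thesis
  proof
    assume le: "secat_G G K \<kappa> E \<epsilon> B \<beta> f p \<le> enat n"
    have "Collect ?P \<noteq> {}"
    proof
      assume "Collect ?P = {}"
      then have "secat_G G K \<kappa> E \<epsilon> B \<beta> f p = Inf {}" unfolding eq by (simp only: image_empty)
      with le show False by (simp add: Inf_enat_def)
    qed
    then obtain k where "k \<in> Collect ?P" by blast
    then have "Inf (enat ` Collect ?P) \<in> enat ` Collect ?P" by (rule wellorder_InfI[OF imageI])
    then obtain m where m: "m \<in> Collect ?P" "Inf (enat ` Collect ?P) = enat m" by blast
    then have "m \<le> n" using le unfolding eq m(2) by (simp only: enat_ord_simps)
    with m(1) show "\<exists>m\<le>n. ?P m" by blast
  next
    assume "\<exists>m\<le>n. ?P m"
    then obtain m where m: "m \<le> n" "?P m" by blast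
    then have "secat_G G K \<kappa> E \<epsilon> B \<beta> f p \<le> enat m" unfolding eq by (auto intro: Inf_lower)
    with m show "secat_G G K \<kappa> E \<epsilon> B \<beta> f p \<le> enat n" by (meson enat_ord_simps(1) order_trans)
  qed
qed

text \<open>Pigeonhole: if both redundant sequences are used with the same index, the \<open>n1 + n2 + 1\<close> indices
  up to \<open>n1 + n2\<close> cannot all be spoiled by the at most \<open>n1\<close> misses of \<open>x\<close> and the at most \<open>n2\<close>
  misses of \<open>y\<close>.\<close>

lemma secat_G_prod_le:
  fixes K1 :: "'k1 topology" and K2 :: "'k2 topology"
  assumes G: "Group.group G" "topspace T = carrier G" "compact_space T"
    and K1: "G_space G T K1 \<kappa>1" "normal_space K1" and K2: "G_space G T K2 \<kappa>2" "normal_space K2"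
    and fp1: "G_map G K1 \<kappa>1 B1 \<beta>1 f1" "G_map G E1 \<epsilon>1 B1 \<beta>1 p1"
    and fp2: "G_map G K2 \<kappa>2 B2 \<beta>2 f2" "G_map G E2 \<epsilon>2 B2 \<beta>2 p2"
  shows "secat_G G (prod_topology K1 K2) (diag_action \<kappa>1 \<kappa>2)
        (prod_topology E1 E2) (diag_action \<epsilon>1 \<epsilon>2)
        (prod_topology B1 B2) (diag_action \<beta>1 \<beta>2) (map_prod f1 f2) (map_prod p1 p2)
      \<le> secat_G G K1 \<kappa>1 E1 \<epsilon>1 B1 \<beta>1 f1 p1 + secat_G G K2 \<kappa>2 E2 \<epsilon>2 B2 \<beta>2 f2 p2"
    (is "?S \<le> ?S1 + ?S2")
proof (cases "?S1 = \<infinity> \<or> ?S2 = \<infinity>")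
  case True
  then show ?thesis by auto
next
  case False
  then obtain N1 N2 where N: "?S1 = enat N1" "?S2 = enat N2" by auto
  from N(1) obtain n1 U1 s1 where 1: "n1 \<le> N1" "(\<Union>i\<le>n1. U1 i) = topspace K1"
    "\<And>i. i \<le> n1 \<Longrightarrow> local_section G K1 \<kappa>1 E1 \<epsilon>1 B1 \<beta>1 f1 p1 (U1 i) (s1 i)"
    using secat_G_le_iff[of G K1 \<kappa>1 E1 \<epsilon>1 B1 \<beta>1 f1 p1 N1] by auto
  from N(2) obtain n2 U2 s2 where 2: "n2 \<le> N2" "(\<Union>i\<le>n2. U2 i) = topspace K2"
    "\<And>i. i \<le> n2 \<Longrightarrow> local_section G K2 \<kappa>2 E2 \<epsilon>2 B2 \<beta>2 f2 p2 (U2 i) (s2 i)"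
    using secat_G_le_iff[of G K2 \<kappa>2 E2 \<epsilon>2 B2 \<beta>2 f2 p2 N2] by auto
  obtain P1 :: "nat \<Rightarrow> 'k1 set" and \<sigma>1 where
    P1: "\<And>k. local_section G K1 \<kappa>1 E1 \<epsilon>1 B1 \<beta>1 f1 p1 (P1 k) (\<sigma>1 k)"
    "\<And>x. x \<in> topspace K1 \<Longrightarrow> finite {k. x \<notin> P1 k} \<and> card {k. x \<notin> P1 k} \<le> n1"
    by (rule redundant_local_sections[OF G K1 fp1 1(3), OF _ equalityD2[OF 1(2)]]) (assumption | rule that)+
  obtain P2 :: "nat \<Rightarrow> 'k2 set" and \<sigma>2 where
    P2: "\<And>k. local_section G K2 \<kappa>2 E2 \<epsilon>2 B2 \<beta>2 f2 p2 (P2 k) (\<sigma>2 k)"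
    "\<And>x. x \<in> topspace K2 \<Longrightarrow> finite {k. x \<notin> P2 k} \<and> card {k. x \<notin> P2 k} \<le> n2"
    by (rule redundant_local_sections[OF G K2 fp2 2(3), OF _ equalityD2[OF 2(2)]]) (assumption | rule that)+
  have "\<exists>k\<le>n1 + n2. x \<in> P1 k \<and> y \<in> P2 k" if xy: "x \<in> topspace K1" "y \<in> topspace K2" for x y
  proof (rule ccontr)
    let ?M = "{k. x \<notin> P1 k} \<union> {k. y \<notin> P2 k}"
    assume "\<not> ?thesis"
    then have "{..n1 + n2} \<subseteq> ?M" by auto
    then have "card {..n1 + n2} \<le> card ?M"
      using P1(2) P2(2) xy by (intro card_mono) auto
    also have "\<dots> \<le> n1 + n2"
      using P1(2)[OF xy(1)] P2(2)[OF xy(2)] card_Un_le[of "{k. x \<notin> P1 k}" "{k. y \<notin> P2 k}"] by linarith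
    finally show False by simp
  qed
  moreover have "P1 k \<subseteq> topspace K1" "P2 k \<subseteq> topspace K2" for k
    using P1(1) P2(1) openin_subset unfolding local_section_def by blast+
  ultimately have "(\<Union>k\<le>n1 + n2. P1 k \<times> P2 k) = topspace (prod_topology K1 K2)"
    by fastforce
  then have "?S \<le> enat (n1 + n2)"
    unfolding secat_G_le_iff
    using local_section_prod[OF P1(1) P2(1)]
    by (intro exI[of _ "n1 + n2"] exI[of _ "\<lambda>k. P1 k \<times> P2 k"]
        exI[of _ "\<lambda>k. map_prod (\<sigma>1 k) (\<sigma>2 k)"] conjI allI impI order_refl)
  also have "\<dots> \<le> ?S1 + ?S2" using 1(1) 2(1) N by simp
  finally show ?thesis .
qed

theorem proposition3p14:
  fixes G :: "'g monoid" and T :: "'g topology" and n :: nat and A :: "'g chart set"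
    and K1 :: "'k1 topology" and K2 :: "'k2 topology"
    and E1 :: "'e1 topology" and E2 :: "'e2 topology"
    and B1 :: "'b1 topology" and B2 :: "'b2 topology"
  assumes "Lie_group G T n A" and "compact_space T"
    and "G_space G T K1 \<kappa>1" and "G_space G T K2 \<kappa>2"
    and "hereditarily normal_space K1" and "hereditarily normal_space K2"
    and "G_space G T E1 \<epsilon>1" and "G_space G T E2 \<epsilon>2"
    and "G_space G T B1 \<beta>1" and "G_space G T B2 \<beta>2"
    and "G_map G E1 \<epsilon>1 B1 \<beta>1 p1" and "G_map G E2 \<epsilon>2 B2 \<beta>2 p2"
    and "G_map G K1 \<kappa>1 B1 \<beta>1 f1" and "G_map G K2 \<kappa>2 B2 \<beta>2 f2"
  shows "G_space G T (prod_topology K1 K2) (diag_action \<kappa>1 \<kappa>2)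
    \<and> G_space G T (prod_topology E1 E2) (diag_action \<epsilon>1 \<epsilon>2)
    \<and> G_space G T (prod_topology B1 B2) (diag_action \<beta>1 \<beta>2)
    \<and> G_map G (prod_topology K1 K2) (diag_action \<kappa>1 \<kappa>2)
        (prod_topology B1 B2) (diag_action \<beta>1 \<beta>2) (map_prod f1 f2)
    \<and> G_map G (prod_topology E1 E2) (diag_action \<epsilon>1 \<epsilon>2)
        (prod_topology B1 B2) (diag_action \<beta>1 \<beta>2) (map_prod p1 p2)
    \<and> secat_G G (prod_topology K1 K2) (diag_action \<kappa>1 \<kappa>2)
        (prod_topology E1 E2) (diag_action \<epsilon>1 \<epsilon>2)
        (prod_topology B1 B2) (diag_action \<beta>1 \<beta>2) (map_prod f1 f2) (map_prod p1 p2)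
      \<le> secat_G G K1 \<kappa>1 E1 \<epsilon>1 B1 \<beta>1 f1 p1 + secat_G G K2 \<kappa>2 E2 \<epsilon>2 B2 \<beta>2 f2 p2"
proof -
  have G: "Group.group G" "topspace T = carrier G"
    using assms(1) unfolding Lie_group_def by blast+
  have norm: "normal_space K1" "normal_space K2"
    using assms(5,6) by (simp_all add: hereditarily_inc)
  show ?thesis
    using secat_G_prod_le[OF G assms(2,3) norm(1) assms(4) norm(2) assms(13,11,14,12)]
      G_space_prod[OF assms(3,4)] G_space_prod[OF assms(7,8)] G_space_prod[OF assms(9,10)]
      G_map_prod[OF assms(13,14)] G_map_prod[OF assms(11,12)]
    by (intro conjI)
qed

end
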